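(* Let $\mathcal{X}$ be a first-countable Hausdorff space and let $G$ be a group of homeomorphisms of $\mathcal{X}$. Assume that the action of $G$ on $\mathcal{X}$ is minimal and that for every open set $U\subseteq \mathcal{X}$, the action of $\mathrm{Rist}_G(U)$ on $U$ is locally minimal. Then, for all regular points $x,y\in\mathcal{X}$, we have $\mathrm{St}_G(x)\cong \mathrm{St}_G(y)$.
   Context: "Neighbourhood" always means open neighbourhood. Let $G$ be a group of homeomorphisms of a topological space $\mathcal{X}$. - $\mathrm{St}_G(x)=\{g\in G\mid g(x)=x\}$. The neighbourhood stabiliser $\mathrm{St}_G^0(x)$ is the subgroup of all $g\in \mathrm{St}_G(x)$ whose set of fixed points contains a neighbourhood of $x$. A point $x\in\mathcal{X}$ is regular if $\mathrm{St}_G^0(x)=\mathrm{St}_G(x)$. - For an open set $U\subseteq\mathcal{X}$, the rigid stabiliser is $\mathrm{Rist}_G(U)=\{g\in G\mid g(x)=x \text{ for all } x\in\mathcal{X}\setminus U\}$. - An action of a group on a space is minimal if the orbit of every point is dense. The action of a group $H$ on a space $Y$ is locally minimal if for every $x\in Y$ there exists a neighbourhood $W\subseteq Y$ of $x$ such that for every $y\in W$, the intersection of the $H$-orbit of $y$ with $W$ is dense in $W$. *)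

theory Defs
  imports "HOL-Analysis.Analysis" "HOL-Algebra.Group_Action"
begin

section \<open>The homeomorphism group of a space\<close>

definition homeo_group :: "('a::topological_space \<Rightarrow> 'a) monoid" where
  "homeo_group = \<lparr>carrier = {f. homeomorphic_map euclidean euclidean f}, mult = (\<circ>), one = id\<rparr>"

abbreviation homeo_subgroup :: "('a::topological_space \<Rightarrow> 'a) set \<Rightarrow> ('a \<Rightarrow> 'a) monoid" where
  "homeo_subgroup H \<equiv> homeo_group\<lparr>carrier := H\<rparr>"

lemma group_homeo_group: "group (homeo_group :: ('a::topological_space \<Rightarrow> 'a) monoid)"
proof (rule groupI)
  fix f :: "'a \<Rightarrow> 'a"
  assume "f \<in> carrier homeo_group"
  then obtain g where g: "homeomorphic_maps euclidean euclidean f g"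
    by (auto simp: homeo_group_def homeomorphic_map_maps)
  then have "homeomorphic_map euclidean euclidean g"
    by (meson homeomorphic_maps_map)
  moreover have "g \<circ> f = id"
    using g by (auto simp: homeomorphic_maps_def)
  ultimately show "\<exists>g\<in>carrier homeo_group. g \<otimes>\<^bsub>homeo_group\<^esub> f = \<one>\<^bsub>homeo_group\<^esub>"
    by (auto simp: homeo_group_def)
qed (auto simp: homeo_group_def o_assoc intro: homeomorphic_map_compose)


section \<open>Minimal and locally minimal actions\<close>

text \<open>The set \<open>H\<close> consists of self-maps of the ambient type, of which only the restriction to
  \<open>topspace Y\<close> matters; it is used with \<open>H\<close> a group of homeomorphisms preserving \<open>topspace Y\<close>.\<close>

definition homeo_orbit :: "('a::topological_space \<Rightarrow> 'a) set \<Rightarrow> 'a \<Rightarrow> 'a set" where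
  "homeo_orbit H x = orbit (homeo_subgroup H) (\<lambda>h. h) x"

definition dense_in :: "'a topology \<Rightarrow> 'a set \<Rightarrow> bool" where
  "dense_in Y S \<longleftrightarrow> Y closure_of S = topspace Y"

definition minimal_action :: "('a::topological_space \<Rightarrow> 'a) set \<Rightarrow> 'a topology \<Rightarrow> bool" where
  "minimal_action H Y \<longleftrightarrow> (\<forall>x\<in>topspace Y. dense_in Y (homeo_orbit H x))"

definition locally_minimal_action :: "('a::topological_space \<Rightarrow> 'a) set \<Rightarrow> 'a topology \<Rightarrow> bool" where
  "locally_minimal_action H Y \<longleftrightarrow>
     (\<forall>x\<in>topspace Y. \<exists>W. openin Y W \<and> x \<in> W \<and>
        (\<forall>y\<in>W. dense_in (subtopology Y W) (homeo_orbit H y \<inter> W)))"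


section \<open>Stabilisers\<close>

definition St :: "('a::topological_space \<Rightarrow> 'a) set \<Rightarrow> 'a \<Rightarrow> ('a \<Rightarrow> 'a) set" where
  "St G x = stabilizer (homeo_subgroup G) (\<lambda>g. g) x"

definition St0 :: "('a::topological_space \<Rightarrow> 'a) set \<Rightarrow> 'a \<Rightarrow> ('a \<Rightarrow> 'a) set" where
  "St0 G x = {g \<in> St G x. \<exists>V. open V \<and> x \<in> V \<and> V \<subseteq> {z. g z = z}}"

definition regular_point :: "('a::topological_space \<Rightarrow> 'a) set \<Rightarrow> 'a \<Rightarrow> bool" where
  "regular_point G x \<longleftrightarrow> St0 G x = St G x"

definition Rist :: "('a::topological_space \<Rightarrow> 'a) set \<Rightarrow> 'a set \<Rightarrow> ('a \<Rightarrow> 'a) set" where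
  "Rist G U = {g \<in> G. \<forall>x\<in>-U. g x = x}"

lemma homeo_orbit_eq: "homeo_orbit H x = (\<lambda>h. h x) ` H"
  by (auto simp: homeo_orbit_def orbit_def)

lemma St_eq: "St G x = {g \<in> G. g x = x}"
  by (simp add: St_def stabilizer_def)

lemma homeo_group_inv:
  fixes f :: "'a::topological_space \<Rightarrow> 'a"
  assumes "f \<in> carrier homeo_group"
  shows "(inv\<^bsub>homeo_group\<^esub> f) (f z) = z"
  using group.l_inv[OF group_homeo_group assms] by (simp add: homeo_group_def fun_eq_iff)

lemma
  fixes G :: "('a::topological_space \<Rightarrow> 'a) set"
  assumes G: "subgroup G homeo_group"
  shows subgroup_St: "subgroup (St G x) homeo_group"
    and subgroup_St0: "subgroup (St0 G x) homeo_group"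
    and subgroup_Rist: "subgroup (Rist G U) homeo_group"
proof -
  interpret group "homeo_group :: ('a \<Rightarrow> 'a) monoid"
    by (rule group_homeo_group)
  have carr: "g \<in> carrier homeo_group" if "g \<in> G" for g
    using that G by (rule subgroup.mem_carrier[rotated])
  have one: "id \<in> G"
    using subgroup.one_closed[OF G] by (simp add: homeo_group_def)
  have mult: "g \<circ> h \<in> G" if "g \<in> G" "h \<in> G" for g h
    using subgroup.m_closed[OF G that] by (simp add: homeo_group_def)
  have inv: "inv\<^bsub>homeo_group\<^esub> g \<in> G" if "g \<in> G" for g
    using subgroup.m_inv_closed[OF G that] .
  have fixed: "(inv\<^bsub>homeo_group\<^esub> g) z = z" if "g \<in> G" "g z = z" for g z
    using homeo_group_inv[OF carr[OF that(1)], of z] that(2) by simp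
  have sub: "subgroup H homeo_group"
    if "H \<subseteq> G" "id \<in> H" "\<And>g h. g \<in> H \<Longrightarrow> h \<in> H \<Longrightarrow> g \<circ> h \<in> H"
      "\<And>g. g \<in> H \<Longrightarrow> inv\<^bsub>homeo_group\<^esub> g \<in> H" for H
    using that carr by (intro subgroupI) (auto simp: homeo_group_def)
  show "subgroup (St G x) homeo_group" "subgroup (Rist G U) homeo_group"
    by (rule sub; auto simp: St_eq Rist_def one mult inv fixed)+
  show "subgroup (St0 G x) homeo_group"
  proof (rule sub)
    fix g h assume "g \<in> St0 G x" "h \<in> St0 G x"
    then obtain V W where "g \<in> St G x" "h \<in> St G x"
      "open V" "x \<in> V" "V \<subseteq> {z. g z = z}" "open W" "x \<in> W" "W \<subseteq> {z. h z = z}"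
      by (auto simp: St0_def)
    then show "g \<circ> h \<in> St0 G x"
      by (auto simp: St0_def St_eq mult subset_iff intro!: exI[of _ "V \<inter> W"])
  next
    fix g assume "g \<in> St0 G x"
    then obtain V where "g \<in> St G x" "open V" "x \<in> V" "V \<subseteq> {z. g z = z}"
      by (auto simp: St0_def)
    then show "inv\<^bsub>homeo_group\<^esub> g \<in> St0 G x"
      by (auto simp: St0_def St_eq inv fixed subset_iff intro!: exI[of _ V])
  qed (auto simp: St0_def St_eq one)
qed

lemma Rist_image:
  assumes "subgroup G homeo_group" "g \<in> Rist G U"
  shows "g ` U = U"
proof -
  have "bij g"
    using subgroup.mem_carrier[OF assms(1)] assms(2)
    by (auto simp: Rist_def homeo_group_def homeomorphic_eq_everything_map bij_def)
  moreover from this have "g ` (- U) = - (g ` U)"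
    by (rule bij_image_Compl_eq)
  moreover have "g ` (- U) = - U"
    using assms(2) by (auto simp: Rist_def image_iff)
  ultimately show ?thesis
    by auto
qed

end

theory Submission
  imports Defs
begin

text \<open>Every element of \<open>St G x\<close> is trivial near \<open>x\<close>, so \<open>St G x\<close> is the increasing union of the
  pointwise fixators in \<open>G\<close> of a neighbourhood base \<open>U n\<close> of \<open>x\<close>. One chooses \<open>g n \<in> G\<close> such that the sets
  \<open>g n ` U n\<close> form a neighbourhood base of \<open>y\<close> and \<open>g (Suc n) = g n \<circ> r\<close> with \<open>r\<close> supported in
  \<open>U n\<close>. As \<open>r\<close> commutes with every map that is trivial on \<open>U n\<close>, the conjugates of \<open>h \<in> St G x\<close> by \<open>g n\<close>
  are eventually constant in \<open>n\<close>, and their limit is the image of \<open>h\<close> under the isomorphism.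
  To find \<open>r\<close>, pull \<open>y\<close> back along \<open>g n\<close> to a point \<open>y'\<close>, use local minimality at \<open>x\<close> to move \<open>x\<close>
  near \<open>y'\<close> by some \<open>p\<close> supported in \<open>U n\<close>, and local minimality at \<open>y'\<close> to move \<open>y'\<close> into the image
  under \<open>p\<close> of a small neighbourhood of \<open>x\<close> by some \<open>s\<close> supported near \<open>y'\<close>; then \<open>r\<close> is \<open>p\<close>
  followed by the inverse of \<open>s\<close>.\<close>

abbreviation inv_fun :: "('a \<Rightarrow> 'b) \<Rightarrow> 'b \<Rightarrow> 'a" where
  "inv_fun \<equiv> inv_into UNIV"

lemma
  fixes G :: "('a::topological_space \<Rightarrow> 'a) set"
  assumes G: "subgroup G homeo_group"
  shows subgroup_homeo_id: "id \<in> G"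
    and subgroup_homeo_comp: "g \<in> G \<Longrightarrow> h \<in> G \<Longrightarrow> g \<circ> h \<in> G"
    and subgroup_homeo_bij: "g \<in> G \<Longrightarrow> bij g"
    and subgroup_homeo_inv: "g \<in> G \<Longrightarrow> inv_fun g \<in> G"
    and subgroup_homeo_open_image: "g \<in> G \<Longrightarrow> open U \<Longrightarrow> open (g ` U)"
proof -
  show "id \<in> G"
    using subgroup.one_closed[OF G] by (simp add: homeo_group_def)
  show "g \<circ> h \<in> G" if "g \<in> G" "h \<in> G"
    using subgroup.m_closed[OF G that] by (simp add: homeo_group_def)
  have homeo: "homeomorphic_map euclidean euclidean g" if "g \<in> G"
    using subgroup.mem_carrier[OF G that] by (simp add: homeo_group_def)
  show bij: "bij g" if "g \<in> G"
    using homeo[OF that] by (simp add: homeomorphic_eq_everything_map bij_def)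
  show "open (g ` U)" if "g \<in> G" "open U"
    using homeomorphic_imp_open_map[OF homeo[OF that(1)]] that(2) by (simp add: open_map_def)
  show "inv_fun g \<in> G" if "g \<in> G"
  proof -
    have "(inv\<^bsub>homeo_group\<^esub> g) \<circ> g = id"
      using homeo_group_inv[OF subgroup.mem_carrier[OF G that]] by (simp add: fun_eq_iff)
    then have "inv\<^bsub>homeo_group\<^esub> g = inv_fun g"
      using bij[OF that] by (metis bij_is_surj comp_assoc comp_id id_comp surj_iff)
    then show ?thesis
      using subgroup.m_inv_closed[OF G that] by simp
  qed
qed

lemma Rist_mono: "U \<subseteq> V \<Longrightarrow> Rist G U \<subseteq> Rist G V"
  by (auto simp: Rist_def)

text \<open>The two maps have disjoint supports: \<open>r\<close> preserves \<open>U\<close> and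
  moves points only inside it, while \<open>h\<close> moves points only outside. Hence they
  commute.\<close>

lemma conj_Rist_fixing:
  assumes "subgroup G homeo_group" "r \<in> Rist G U" "\<And>z. z \<in> U \<Longrightarrow> h z = z" "bij h"
  shows "r \<circ> h \<circ> inv_fun r = h"
proof -
  have "bij r"
    using assms(1,2) subgroup_homeo_bij by (auto simp: Rist_def)
  have "r (h z) = h (r z)" for z
  proof (cases "z \<in> U")
    case True
    then have "r z \<in> U"
      using Rist_image[OF assms(1,2)] by blast
    with True show ?thesis
      by (simp add: assms(3))
  next
    case False
    \<comment> \<open>If \<open>h z\<close> were in \<open>U\<close>, then
      \<open>h (h z) = h z\<close>, and injectivity would give \<open>h z = z\<close>, contrary to
      \<open>z\<close> lying outside \<open>U\<close>.\<close>
    then have "h z \<notin> U"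
      using assms(3)[of "h z"] \<open>bij h\<close> by (metis bij_pointE)
    with False show ?thesis
      using assms(2) by (simp add: Rist_def)
  qed
  then have "r \<circ> h = h \<circ> r"
    by (simp add: fun_eq_iff)
  then show ?thesis
    using \<open>bij r\<close> by (metis bij_is_surj comp_assoc comp_id surj_iff)
qed

lemma regular_pointE:
  assumes "regular_point G x" "h \<in> St G x"
  obtains V where "open V" "x \<in> V" "\<And>z. z \<in> V \<Longrightarrow> h z = z"
proof -
  have "h \<in> St0 G x"
    using assms by (simp add: regular_point_def)
  then show ?thesis
    using that by (auto simp: St0_def)
qed

section \<open>The isomorphism as a limit of conjugations\<close>

lemma St_iso_of_conjugators:
  fixes G :: "('a::topological_space \<Rightarrow> 'a) set"
  assumes G: "subgroup G homeo_group"
    and x: "regular_point G x" and y: "regular_point G y"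
    and g: "\<And>n. g n \<in> G" and r: "\<And>n. \<exists>r\<in>Rist G (U n). g (Suc n) = g n \<circ> r"
    and U: "decseq U" and xU: "\<And>n. x \<in> U n" and yU: "\<And>n. y \<in> g n ` U n"
    and basex: "\<And>V. open V \<Longrightarrow> x \<in> V \<Longrightarrow> \<exists>n. U n \<subseteq> V"
    and basey: "\<And>V. open V \<Longrightarrow> y \<in> V \<Longrightarrow> \<exists>n. g n ` U n \<subseteq> V"
  shows "homeo_subgroup (St G x) \<cong> homeo_subgroup (St G y)"
proof -
  define fixing where "fixing h n \<longleftrightarrow> (\<forall>z\<in>U n. h z = z)" for h :: "'a \<Rightarrow> 'a" and n
  define c where "c n h = g n \<circ> h \<circ> inv_fun (g n)" for n h
  \<comment> \<open>The least index is only a canonical choice: by \<open>c_const\<close>, every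
    \<open>n\<close> with \<open>fixing h n\<close> yields the same conjugate.\<close>
  define \<phi> where "\<phi> h = c (LEAST n. fixing h n) h" for h
  have bij: "bij (g n)" for n
    using subgroup_homeo_bij[OF G g] .
  have g_inv: "inv_fun (g n) (g n z) = z" "g n (inv_fun (g n) z) = z" for n z
    using bij[of n] by (simp_all add: bij_is_inj bij_is_surj surj_f_inv_f)
  have ex_fixing: "\<exists>n. fixing h n" if h: "h \<in> St G x" for h
  proof -
    obtain V where "open V" "x \<in> V" "\<And>z. z \<in> V \<Longrightarrow> h z = z"
      using regular_pointE[OF x h] by blast
    with basex[of V] show ?thesis
      by (auto simp: fixing_def)
  qed
  have fixing_mono: "fixing h n" if "fixing h m" "m \<le> n" for h m n
    using that decseqD[OF U that(2)] by (auto simp: fixing_def)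
  have c_const: "c n h = c m h" if "h \<in> G" "fixing h m" "m \<le> n" for h m n
    using that(3)
  proof (induction rule: dec_induct)
    case (step k)
    obtain s where s: "s \<in> Rist G (U k)" "g (Suc k) = g k \<circ> s"
      using r by blast
    then have "bij s"
      using G subgroup_homeo_bij by (auto simp: Rist_def)
    \<comment> \<open>Conjugation by \<open>g k \<circ> s\<close> is conjugation by \<open>s\<close>
      followed by conjugation by \<open>g k\<close>; the inner one does nothing because
      \<open>h\<close> is trivial on \<open>U k\<close>, which supports \<open>s\<close>.\<close>
    have "c (Suc k) h = g k \<circ> (s \<circ> h \<circ> inv_fun s) \<circ> inv_fun (g k)"
      by (simp add: c_def s(2) o_inv_distrib[OF bij \<open>bij s\<close>] o_assoc)
    also have "s \<circ> h \<circ> inv_fun s = h"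
      using fixing_mono[OF that(2)] step.hyps subgroup_homeo_bij[OF G that(1)]
      by (intro conj_Rist_fixing[OF G s(1)]) (auto simp: fixing_def)
    finally show ?case
      using step.IH by (simp add: c_def)
  qed simp
  have \<phi>_eq: "\<phi> h = c n h" if "h \<in> G" "fixing h n" for h n
    unfolding \<phi>_def using c_const[OF that(1) LeastI[of "fixing h"] Least_le] that(2) by metis
  have c_in_St: "c n h \<in> St G y" if "h \<in> G" "fixing h n" for h n
  proof -
    obtain z where "z \<in> U n" "y = g n z"
      using yU by blast
    then show ?thesis
      using that by (auto simp: St_eq c_def fixing_def g_inv
          intro!: subgroup_homeo_comp[OF G] subgroup_homeo_inv[OF G] g)
  qed
  have c_comp: "c n (h \<circ> k) = c n h \<circ> c n k" for n h k
    by (simp add: c_def fun_eq_iff g_inv)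
  have common: "\<exists>n. fixing h n \<and> fixing k n" if hk: "h \<in> St G x" "k \<in> St G x" for h k
  proof -
    obtain m n where "fixing h m" "fixing k n"
      using ex_fixing hk by blast
    then show ?thesis
      using fixing_mono by (metis max.cobounded1 max.cobounded2)
  qed
  have "\<phi> \<in> hom (homeo_subgroup (St G x)) (homeo_subgroup (St G y))"
  proof (rule homI)
    fix h assume h: "h \<in> carrier (homeo_subgroup (St G x))"
    then obtain n where "fixing h n"
      using ex_fixing by auto
    with h show "\<phi> h \<in> carrier (homeo_subgroup (St G y))"
      using \<phi>_eq[of h n] c_in_St by (simp add: St_eq)
  next
    fix h k assume "h \<in> carrier (homeo_subgroup (St G x))" "k \<in> carrier (homeo_subgroup (St G x))"
    then have hk: "h \<in> St G x" "k \<in> St G x" "h \<in> G" "k \<in> G"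
      by (simp_all add: St_eq)
    obtain n where n: "fixing h n" "fixing k n"
      using common hk by blast
    then have "fixing (h \<circ> k) n"
      by (simp add: fixing_def)
    with n hk have "\<phi> (h \<circ> k) = \<phi> h \<circ> \<phi> k"
      by (simp add: \<phi>_eq[of _ n] c_comp subgroup_homeo_comp[OF G])
    then show "\<phi> (h \<otimes>\<^bsub>homeo_subgroup (St G x)\<^esub> k) = \<phi> h \<otimes>\<^bsub>homeo_subgroup (St G y)\<^esub> \<phi> k"
      by (simp add: homeo_group_def)
  qed
  moreover have "inj_on \<phi> (St G x)"
  proof (rule inj_onI)
    fix h k assume hk: "h \<in> St G x" "k \<in> St G x" and eq: "\<phi> h = \<phi> k"
    then obtain n where "fixing h n" "fixing k n"
      using common by blast
    with hk eq have c_eq: "c n h = c n k"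
      by (simp add: \<phi>_eq[of _ n] St_eq)
    have "h z = k z" for z
      using fun_cong[OF c_eq, of "g n z"] bij_is_inj[OF bij, of n]
      by (simp add: c_def g_inv inj_eq)
    then show "h = k" ..
  qed
  moreover have "k \<in> \<phi> ` St G x" if k: "k \<in> St G y" for k
  proof -
    obtain V where "open V" "y \<in> V" "\<And>z. z \<in> V \<Longrightarrow> k z = z"
      using regular_pointE[OF y k] by blast
    then obtain n where n: "\<And>z. z \<in> U n \<Longrightarrow> k (g n z) = g n z"
      using basey[of V] by blast
    define h where "h = inv_fun (g n) \<circ> k \<circ> g n"
    have "h \<in> G"
      using k by (auto simp: h_def St_eq intro!: subgroup_homeo_comp[OF G] subgroup_homeo_inv[OF G] g)
    moreover have h_fixing: "fixing h n"
      by (simp add: fixing_def h_def n g_inv)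
    ultimately have "h \<in> St G x"
      using xU[of n] by (simp add: St_eq fixing_def)
    moreover have "\<phi> h = k"
      using \<phi>_eq[OF \<open>h \<in> G\<close> h_fixing] by (simp add: c_def h_def fun_eq_iff g_inv)
    ultimately show ?thesis
      by blast
  qed
  ultimately have "\<phi> \<in> iso (homeo_subgroup (St G x)) (homeo_subgroup (St G y))"
    by (auto simp: iso_def bij_betw_def hom_def)
  then show ?thesis
    by (rule is_isoI)
qed

section \<open>Construction of the conjugators from local minimality\<close>

lemma locally_minimal_actionE:
  fixes U :: "'a::topological_space set"
  assumes "locally_minimal_action H (top_of_set U)" "open U" "z \<in> U"
  obtains W where "open W" "z \<in> W" "W \<subseteq> U"
    "\<And>T. open T \<Longrightarrow> T \<inter> W \<noteq> {} \<Longrightarrow> \<exists>h\<in>H. h z \<in> T \<inter> W"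
proof -
  obtain W where W: "openin (top_of_set U) W" "z \<in> W"
    and dense: "dense_in (subtopology (top_of_set U) W) (homeo_orbit H z \<inter> W)"
    using assms(1,3) unfolding locally_minimal_action_def by (metis topspace_euclidean_subtopology)
  have "open W" "W \<subseteq> U"
    using W(1) assms(2) by (auto simp: openin_open_eq)
  then have "W \<subseteq> closure (homeo_orbit H z \<inter> W)"
    using dense by (auto simp: dense_in_def subtopology_subtopology Int_absorb1 Int_absorb2
        closure_of_subtopology)
  then have "\<exists>h\<in>H. h z \<in> T \<inter> W" if "open T" "T \<inter> W \<noteq> {}" for T
    using that open_Int_closure_eq_empty[OF that(1), of "homeo_orbit H z \<inter> W"]
    by (fastforce simp: homeo_orbit_eq)
  with \<open>open W\<close> W(2) \<open>W \<subseteq> U\<close> show ?thesis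
    by (rule that)
qed

lemma corrected_conjugator:
  fixes G :: "('a::topological_space \<Rightarrow> 'a) set"
  assumes G: "subgroup G homeo_group"
    and lm: "\<And>U. open U \<Longrightarrow> locally_minimal_action (Rist G U) (top_of_set U)"
    and g: "g \<in> G" and U: "open U" "W \<subseteq> U" and W: "open W" "x \<in> W" "y \<in> g ` W"
    and dense: "\<forall>T. open T \<longrightarrow> T \<inter> W \<noteq> {} \<longrightarrow> (\<exists>h\<in>Rist G U. h x \<in> T)"
    and A: "open A" "x \<in> A" and B: "open B" "y \<in> B"
  obtains r U' W' where "r \<in> Rist G U" "open U'" "U' \<subseteq> U" "U' \<subseteq> A" "(g \<circ> r) ` U' \<subseteq> B"
    "open W'" "W' \<subseteq> U'" "x \<in> W'" "y \<in> (g \<circ> r) ` W'"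
    "\<forall>T. open T \<longrightarrow> T \<inter> W' \<noteq> {} \<longrightarrow> (\<exists>h\<in>Rist G U'. h x \<in> T)"
proof -
  have bij: "bij h" if "h \<in> G" for h
    using subgroup_homeo_bij[OF G that] .
  have vimage: "h -` T = inv_fun h ` T" "open (h -` T)" if "h \<in> G" "open T" for h T
    using that subgroup_homeo_open_image[OF G subgroup_homeo_inv[OF G]]
    by (simp_all add: bij_vimage_eq_inv_image bij)
  obtain y' where y': "y' \<in> W" "y = g y'"
    using W(3) by blast
  \<comment> \<open>The correction \<open>s\<close> will be supported in \<open>N\<close>: inside
    \<open>U\<close>, so that \<open>r\<close> stays in \<open>Rist G U\<close>, and inside the
    preimage of \<open>B\<close>, so that images under \<open>g\<close> remain in
    \<open>B\<close>.\<close>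
  define N where "N = g -` B \<inter> U"
  have N: "open N" "y' \<in> N" "N \<subseteq> U"
    using g B U W(1) y' vimage(2) by (auto simp: N_def)
  obtain M where M: "open M" "y' \<in> M" "M \<subseteq> N"
    "\<And>T. open T \<Longrightarrow> T \<inter> M \<noteq> {} \<Longrightarrow> \<exists>h\<in>Rist G N. h y' \<in> T \<inter> M"
    using locally_minimal_actionE[OF lm[OF N(1)] N(1,2)] by blast
  \<comment> \<open>The density hypothesis applies to \<open>M\<close> because \<open>y'\<close>
    lies in both \<open>M\<close> and \<open>W\<close>.\<close>
  obtain p where p: "p \<in> Rist G U" "p x \<in> M"
    using dense M(1,2) y'(1) by blast
  have pG: "p \<in> G"
    using p(1) by (simp add: Rist_def)
  define U' where "U' = p -` M \<inter> A \<inter> U"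
  have U': "open U'" "x \<in> U'" "U' \<subseteq> U" "U' \<subseteq> A" "p ` U' \<subseteq> M"
    using p A U W(2) M(1) vimage(2)[OF pG] by (auto simp: U'_def)
  \<comment> \<open>Local minimality at \<open>x\<close> for the smaller set \<open>U'\<close>
    supplies the density needed at the next stage.\<close>
  obtain W' where W': "open W'" "x \<in> W'" "W' \<subseteq> U'"
    "\<And>T. open T \<Longrightarrow> T \<inter> W' \<noteq> {} \<Longrightarrow> \<exists>h\<in>Rist G U'. h x \<in> T \<inter> W'"
    using locally_minimal_actionE[OF lm[OF U'(1)] U'(1,2)] by blast
  have "p x \<in> p ` W' \<inter> M"
    using W'(2) p(2) by blast
  then obtain s where s: "s \<in> Rist G N" "s y' \<in> p ` W'"
    using M(4)[OF subgroup_homeo_open_image[OF G pG W'(1)]] by blast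
  have sG: "s \<in> G"
    using s(1) by (simp add: Rist_def)
  have s_inv: "inv_fun s (s z) = z" "s (inv_fun s z) = z" for z
    using bij[OF sG] by (simp_all add: bij_is_inj bij_is_surj surj_f_inv_f)
  define r where "r = inv_fun s \<circ> p"
  have "inv_fun s z = z" if "z \<notin> N" for z
    using s(1) s_inv(1)[of z] that by (simp add: Rist_def)
  then have "inv_fun s \<in> Rist G N"
    using subgroup_homeo_inv[OF G sG] by (simp add: Rist_def)
  then have "inv_fun s \<in> Rist G U" and invN: "inv_fun s ` N = N"
    using Rist_mono[OF N(3)] Rist_image[OF G] by blast+
  then have rU: "r \<in> Rist G U"
    using p(1) subgroup_homeo_comp[OF G] by (auto simp: r_def Rist_def)
  have rB: "(g \<circ> r) ` U' \<subseteq> B"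
  proof -
    have "r ` U' \<subseteq> N"
      using U'(5) M(3) invN unfolding r_def image_comp[symmetric] by blast
    then show ?thesis
      by (auto simp: N_def)
  qed
  have ry: "y \<in> (g \<circ> r) ` W'"
  proof -
    obtain w where "w \<in> W'" "s y' = p w"
      using s(2) by blast
    then have "y = (g \<circ> r) w"
      using y'(2) s_inv(1)[of y'] by (simp add: r_def)
    with \<open>w \<in> W'\<close> show ?thesis
      by blast
  qed
  have "\<forall>T. open T \<longrightarrow> T \<inter> W' \<noteq> {} \<longrightarrow> (\<exists>h\<in>Rist G U'. h x \<in> T)"
    using W'(4) by blast
  then show ?thesis
    by (rule that[OF rU U'(1,3,4) rB W'(1,3,2) ry])
qed

theorem corollary2:
  fixes G :: "('a::{t2_space, first_countable_topology} \<Rightarrow> 'a) set"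
    and x y :: 'a
  assumes "subgroup G homeo_group"
    and "minimal_action G euclidean"
    and "\<And>U. open U \<Longrightarrow> locally_minimal_action (Rist G U) (top_of_set U)"
    and "regular_point G x"
    and "regular_point G y"
  shows "homeo_subgroup (St G x) \<cong> homeo_subgroup (St G y)"
proof -
  obtain A :: "nat \<Rightarrow> 'a set" where A: "\<And>n. open (A n)" "\<And>n. x \<in> A n"
    "\<And>V. open V \<Longrightarrow> x \<in> V \<Longrightarrow> \<exists>n. A n \<subseteq> V"
    using first_countable_basis[of x] by metis
  obtain B :: "nat \<Rightarrow> 'a set" where B: "\<And>n. open (B n)" "\<And>n. y \<in> B n"
    "\<And>V. open V \<Longrightarrow> y \<in> V \<Longrightarrow> \<exists>n. B n \<subseteq> V"
    using first_countable_basis[of y] by metis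
  define P where "P = (\<lambda>(g, U, W). g \<in> G \<and> open U \<and> W \<subseteq> U \<and> open W \<and> x \<in> W \<and> y \<in> g ` W \<and>
    (\<forall>T. open T \<longrightarrow> T \<inter> W \<noteq> {} \<longrightarrow> (\<exists>h\<in>Rist G U. h x \<in> T)))"
  \<comment> \<open>The index is shifted: stage \<open>Suc n\<close> is controlled by
    \<open>A n\<close> and \<open>B n\<close>, which leaves the initial triple unconstrained by the
    two bases.\<close>
  define Q where "Q = (\<lambda>n (g, U, W :: 'a set) (g', U', W' :: 'a set). U' \<subseteq> U \<and> U' \<subseteq> A n \<and>
    g' ` U' \<subseteq> B n \<and> (\<exists>r\<in>Rist G U. g' = g \<circ> r))"
  have "\<exists>f. \<forall>n. P (f n) \<and> Q n (f n) (f (Suc n))"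
  proof (rule dependent_nat_choice)
    \<comment> \<open>Minimality of \<open>G\<close> is exactly the density invariant for the
      starting triple \<open>(id, UNIV, UNIV)\<close>.\<close>
    have "closure (homeo_orbit G x) = UNIV"
      using assms(2) by (simp add: minimal_action_def dense_in_def)
    then have "\<exists>h\<in>G. h x \<in> T" if "open T" "T \<noteq> {}" for T
      using that open_Int_closure_eq_empty[OF that(1), of "homeo_orbit G x"]
      by (fastforce simp: homeo_orbit_eq)
    moreover have "Rist G UNIV = G"
      by (simp add: Rist_def)
    ultimately have "P (id, UNIV, UNIV)"
      using subgroup_homeo_id[OF assms(1)] by (simp add: P_def Bex_def)
    then show "\<exists>t. P t" ..
  next
    fix t n assume "P t"
    obtain g U W where t: "t = (g, U, W)"
      by (cases t)
    with \<open>P t\<close> have g: "g \<in> G" and PU: "open U" "W \<subseteq> U" "open W" "x \<in> W" "y \<in> g ` W"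
      "\<forall>T. open T \<longrightarrow> T \<inter> W \<noteq> {} \<longrightarrow> (\<exists>h\<in>Rist G U. h x \<in> T)"
      by (auto simp: P_def)
    obtain r U' W' where r: "r \<in> Rist G U" and "open U'" "U' \<subseteq> U" "U' \<subseteq> A n" "(g \<circ> r) ` U' \<subseteq> B n"
      "open W'" "W' \<subseteq> U'" "x \<in> W'" "y \<in> (g \<circ> r) ` W'"
      "\<forall>T. open T \<longrightarrow> T \<inter> W' \<noteq> {} \<longrightarrow> (\<exists>h\<in>Rist G U'. h x \<in> T)"
      by (rule corrected_conjugator[OF assms(1,3) g PU A(1)[of n] A(2) B(1)[of n] B(2)]) blast
    moreover have "g \<circ> r \<in> G"
      using g r subgroup_homeo_comp[OF assms(1)] by (auto simp: Rist_def)
    ultimately have "P (g \<circ> r, U', W') \<and> Q n t (g \<circ> r, U', W')"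
      unfolding P_def Q_def t prod.case by blast
    then show "\<exists>t'. P t' \<and> Q n t t'"
      by blast
  qed
  then obtain f where f: "\<And>n. P (f n)" "\<And>n. Q n (f n) (f (Suc n))"
    by blast
  define g where "g n = fst (f n)" for n
  define U where "U n = fst (snd (f n))" for n
  have PU: "g n \<in> G" "x \<in> U n" "y \<in> g n ` U n" for n
    using f(1)[of n] by (auto simp: P_def g_def U_def split_beta)
  have QU: "U (Suc n) \<subseteq> U n" "U (Suc n) \<subseteq> A n" "g (Suc n) ` U (Suc n) \<subseteq> B n"
    "\<exists>r\<in>Rist G (U n). g (Suc n) = g n \<circ> r" for n
    using f(2)[of n] by (auto simp: Q_def g_def U_def split_beta)
  show ?thesis
  proof (rule St_iso_of_conjugators[OF assms(1,4,5)])
    show "decseq U"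
      using QU(1) by (rule decseq_SucI)
    show "\<exists>n. U n \<subseteq> V" if "open V" "x \<in> V" for V
      using A(3)[OF that] QU(2) by (meson subset_trans)
    show "\<exists>n. g n ` U n \<subseteq> V" if "open V" "y \<in> V" for V
      using B(3)[OF that] QU(3) by (meson subset_trans)
  qed (rule PU QU)+
qed

end
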